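(* Let $K^\Lambda\subset\mathbb{R}^3\times\mathbb{R}^3\times\mathcal{S}^{3\times3}\times\mathbb{R}^3$ be the $\Lambda$-convex hull of the constraint set $K$ of 3D ideal MHD. Then $\operatorname{int}(K^\Lambda)=\emptyset$. However, the point $(0,0,0,0)$ belongs to the relative interior of $K^\Lambda$ in the set $\{(u,b,S,a)\in\mathbb{R}^3\times\mathbb{R}^3\times\mathcal{S}^{3\times3}\times\mathbb{R}^3: b\cdot a=0\}$.
   Context: $\mathcal{S}^{3\times3}$ is the space of symmetric real $3\times3$ matrices; $(v\otimes w)_{ij}=v_iw_j$. Constraint set: $K=\{(u,b,S,a)\in\mathbb{R}^3\times\mathbb{R}^3\times\mathcal{S}^{3\times3}\times\mathbb{R}^3: S=u\otimes u-b\otimes b+\Pi I\text{ for some }\Pi\in\mathbb{R},\ a=b\times u\}$. Wave cone: $\Lambda$ is the set of $(u,b,S,a)\in\mathbb{R}^3\times\mathbb{R}^3\times\mathcal{S}^{3\times3}\times\mathbb{R}^3$ for which there is $(\xi,c)\in(\mathbb{R}^3\setminus\{0\})\times\mathbb{R}$ with $S\xi+cu=0$, $\xi\times a+cb=0$, $u\cdot\xi=b\cdot\xi=0$. A function $f:\mathbb{R}^3\times\mathbb{R}^3\times\mathcal{S}^{3\times3}\times\mathbb{R}^3\to\mathbb{R}$ is $\Lambda$-convex if $t\mapsto f(V+tW)$ is convex on $\mathbb{R}$ for every $V$ and every $W\in\Lambda$. The $\Lambda$-convex hull $K^\Lambda$ is the set of points $W$ such that $f(W)\le0$ for every $\Lambda$-convex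 $f$ with $f|_K\le0$. The relative interior of a subset in a set $X$ is its interior with respect to the subspace topology of $X$. *)

theory Defs
  imports "HOL-Analysis.Analysis"
begin

text \<open>
  The state space \<open>R^3 \<times> R^3 \<times> S^{3x3} \<times> R^3\<close> is the linear subspace
  \<open>mhd_space\<close> of the type \<open>mhd_state\<close>, whose third component is an arbitrary \<open>3 \<times> 3\<close>
  matrix. Topological notions refer to \<open>top_of_set mhd_space\<close>: in the ambient type every
  subset of \<open>mhd_space\<close> has empty interior.
\<close>

type_synonym mhd_state = "(real^3) \<times> (real^3) \<times> (real^3^3) \<times> (real^3)"

definition mhd_space :: "mhd_state set" where
  "mhd_space = {(u, b, S, a). transpose S = S}"

definition outer_product :: "real^3 \<Rightarrow> real^3 \<Rightarrow> real^3^3" where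
  "outer_product v w = (\<chi> i j. v $ i * w $ j)"

definition mhd_constraint :: "mhd_state set" where
  "mhd_constraint = {(u, b, S, a) \<in> mhd_space.
     (\<exists>p::real. S = outer_product u u - outer_product b b + p *\<^sub>R mat 1) \<and> a = cross3 b u}"

definition wave_cone :: "mhd_state set" where
  "wave_cone = {(u, b, S, a) \<in> mhd_space.
     \<exists>(\<xi>::real^3) (c::real). \<xi> \<noteq> 0 \<and>
       S *v \<xi> + c *\<^sub>R u = 0 \<and> cross3 \<xi> a + c *\<^sub>R b = 0 \<and> u \<bullet> \<xi> = 0 \<and> b \<bullet> \<xi> = 0}"

text \<open>
  Functions on \<open>mhd_space\<close> are represented by total functions on the ambient type, of which
  only the values on \<open>mhd_space\<close> matter: for \<open>V\<close> and \<open>W\<close> in \<open>mhd_space\<close> the whole line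
  \<open>V + t W\<close> stays in \<open>mhd_space\<close>.
\<close>

definition wave_convex :: "(mhd_state \<Rightarrow> real) \<Rightarrow> bool" where
  "wave_convex f \<longleftrightarrow>
     (\<forall>V\<in>mhd_space. \<forall>W\<in>wave_cone. convex_on UNIV (\<lambda>t::real. f (V + t *\<^sub>R W)))"

definition wave_convex_hull :: "mhd_state set \<Rightarrow> mhd_state set" where
  "wave_convex_hull A =
     {W \<in> mhd_space. \<forall>f. wave_convex f \<and> (\<forall>V\<in>A. f V \<le> 0) \<longrightarrow> f W \<le> 0}"

end

(*
  For W = (u, b, S, a) in the wave cone the quadratic form b . a vanishes, so it is affine along
  wave directions; as it also vanishes on K, the hull lies in {b . a = 0}. Conversely every point
  of {b . a = 0} is reached from K by successive splittings V = ((V + W) + (V - W)) / 2, W in the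
  wave cone. For fixed (u, b) with a = b x u, splitting u into u + w and u - w adds w (x) w to S,
  and the directions (0, 0, D, 0) with det D = 0 then produce every symmetric S. Once S is free,
  splitting (u, b) along (v, d) with v, d orthogonal to \<xi> shifts a by d x v, which can be any
  multiple of \<xi>; the only constraint on \<xi> is \<xi> . b = 0. Hence the hull is exactly {b . a = 0}.
*)
theory Submission
  imports Defs
begin

section \<open>Elementary properties of the hull\<close>

lemma wave_convex_hull_subset: "wave_convex_hull A \<subseteq> mhd_space"
  by (auto simp: wave_convex_hull_def)

lemma subset_wave_convex_hull:
  assumes "A \<subseteq> mhd_space"
  shows "A \<subseteq> wave_convex_hull A"
  using assms by (auto simp: wave_convex_hull_def)

text \<open>Convexity of \<open>f\<close> on the line through \<open>V\<close> in direction
  \<open>W\<close>, evaluated at parameters 1 and -1 with equal weights, bounds \<open>f V\<close>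
  by the mean of two nonpositive values. All points of the hull beyond the constraint set are
  produced by this rule.\<close>

lemma wave_convex_hull_midpoint:
  assumes V: "V \<in> mhd_space" and W: "W \<in> wave_cone"
    and plus: "V + W \<in> wave_convex_hull A" and minus: "V - W \<in> wave_convex_hull A"
  shows "V \<in> wave_convex_hull A"
  unfolding wave_convex_hull_def
proof (intro CollectI conjI allI impI)
  fix f assume f: "wave_convex f \<and> (\<forall>V\<in>A. f V \<le> 0)"
  have "convex_on UNIV (\<lambda>t::real. f (V + t *\<^sub>R W))"
    using f V W by (auto simp: wave_convex_def)
  from convex_onD[OF this, of "1/2" "1" "-1"]
  have "f V \<le> (1/2) * f (V + W) + (1/2) * f (V - W)" by simp
  moreover have "f (V + W) \<le> 0" "f (V - W) \<le> 0"
    using plus minus f by (auto simp: wave_convex_hull_def)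
  ultimately show "f V \<le> 0" by simp
qed (rule V)

section \<open>The quadratic form b . a as an obstruction\<close>

lemma wave_cone_imp_orthogonal:
  assumes "(u, b, S, a) \<in> wave_cone"
  shows "b \<bullet> a = 0"
proof -
  obtain \<xi> :: "real^3" and c where \<xi>: "\<xi> \<noteq> 0" and eq: "cross3 \<xi> a + c *\<^sub>R b = 0" and orth: "b \<bullet> \<xi> = 0"
    using assms by (auto simp: wave_cone_def)
  \<comment> \<open>If \<open>c = 0\<close>, then \<open>a\<close> is parallel to
    \<open>\<xi>\<close>, hence orthogonal to \<open>b\<close>. Otherwise the inner product with
    \<open>a\<close> removes the cross product and leaves
    \<open>c * (b \<bullet> a) = 0\<close>.\<close>
  show ?thesis
  proof (cases "c = 0")
    case True
    then have "cross3 \<xi> a = 0" using eq by simp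
    then show ?thesis
      using \<xi> orth by (auto simp: cross_eq_0 collinear_lemma)
  next
    case False
    have "(cross3 \<xi> a + c *\<^sub>R b) \<bullet> a = 0" using eq by simp
    then show ?thesis using False by (simp add: inner_add_left dot_cross_self)
  qed
qed

text \<open>The coefficient of \<open>t^2\<close> along a wave direction is \<open>k\<close> times
  the form evaluated at that direction, which is zero, so only an affine function of
  \<open>t\<close> remains. Having both signs of \<open>k\<close> available later turns the
  inequality on the hull into an equality.\<close>

lemma wave_convex_inner_magnetic:
  fixes k :: real
  shows "wave_convex (\<lambda>(u, b, S, a). k * (b \<bullet> a))"
  unfolding wave_convex_def
proof (intro ballI)
  fix V W :: mhd_state
  assume W: "W \<in> wave_cone"
  obtain u b S a where V: "V = (u, b, S, a)" by (cases V) auto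
  obtain u' b' S' a' where W': "W = (u', b', S', a')" by (cases W) auto
  have "b' \<bullet> a' = 0" using W W' wave_cone_imp_orthogonal by blast
  then have "(\<lambda>t. case V + t *\<^sub>R W of (u, b, S, a) \<Rightarrow> k * (b \<bullet> a)) =
      (\<lambda>t::real. k * (b \<bullet> a) + t * (k * (b \<bullet> a' + b' \<bullet> a)))"
    by (auto simp: V W' inner_simps algebra_simps)
  moreover have "convex_on UNIV (\<lambda>t::real. k * (b \<bullet> a) + t * (k * (b \<bullet> a' + b' \<bullet> a)))"
    by (rule convex_onI) (auto simp: algebra_simps)
  ultimately show "convex_on UNIV (\<lambda>t. case V + t *\<^sub>R W of (u, b, S, a) \<Rightarrow> k * (b \<bullet> a))"
    by simp
qed

lemma wave_convex_hull_orthogonal: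
  assumes "(u, b, S, a) \<in> wave_convex_hull mhd_constraint"
  shows "b \<bullet> a = 0"
proof -
  have "k * (b \<bullet> a) \<le> 0" for k :: real
  proof -
    have "\<forall>V\<in>mhd_constraint. (\<lambda>(u, b, S, a). k * (b \<bullet> a)) V \<le> 0"
      by (auto simp: mhd_constraint_def dot_cross_self)
    then have "(\<lambda>(u, b, S, a). k * (b \<bullet> a)) (u, b, S, a) \<le> 0"
      using assms wave_convex_inner_magnetic[of k] unfolding wave_convex_hull_def by blast
    then show ?thesis by simp
  qed
  from this[of 1] this[of "-1"] show ?thesis by simp
qed

section \<open>Symmetric matrices and outer products\<close>

lemma mhd_spaceI: "transpose S = S \<Longrightarrow> (u, b, S, a) \<in> mhd_space"
  by (simp add: mhd_space_def)

lemma transpose_add: "transpose (A + B) = transpose A + transpose B"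
  by (simp add: transpose_def vec_eq_iff)

lemma transpose_diff: "transpose (A - B) = transpose A - transpose B"
  for A :: "real^'n^'m"
  by (simp add: transpose_def vec_eq_iff)

lemma transpose_outer_product: "transpose (outer_product v w) = outer_product w v"
  by (simp add: outer_product_def transpose_def vec_eq_iff)

lemmas transpose_simps =
  transpose_add transpose_diff transpose_scalar transpose_outer_product transpose_mat

lemma outer_product_mult_vector: "outer_product v w *v x = (w \<bullet> x) *\<^sub>R v"
  by (simp add: outer_product_def matrix_vector_mult_def vec_eq_iff inner_vec_def
      sum_distrib_left sum_distrib_right mult.commute mult.left_commute)

lemma outer_product_add_left: "outer_product (v + w) x = outer_product v x + outer_product w x"
  and outer_product_add_right: "outer_product x (v + w) = outer_product x v + outer_product x w"
  and outer_product_diff_left: "outer_product (v - w) x = outer_product v x - outer_product w x"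
  and outer_product_diff_right: "outer_product x (v - w) = outer_product x v - outer_product x w"
  and outer_product_scaleR_left: "outer_product (r *\<^sub>R v) x = r *\<^sub>R outer_product v x"
  and outer_product_scaleR_right: "outer_product x (r *\<^sub>R v) = r *\<^sub>R outer_product x v"
  by (simp_all add: outer_product_def vec_eq_iff algebra_simps)

lemmas outer_product_simps =
  outer_product_add_left outer_product_add_right outer_product_diff_left outer_product_diff_right
  outer_product_scaleR_left outer_product_scaleR_right

lemma orthogonal_to_pair_exists:
  fixes v w :: "real^3"
  obtains \<xi> where "\<xi> \<noteq> 0" "v \<bullet> \<xi> = 0" "w \<bullet> \<xi> = 0"
proof -
  have "dim {v, w} \<le> card {v, w}" by (intro dim_le_card') simp
  also have "\<dots> \<le> 2" by (simp add: card_insert_if)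
  finally have "dim {v, w} < DIM(real^3)" by simp
  then obtain \<xi> where \<xi>: "\<xi> \<noteq> 0" "\<And>y. y \<in> span {v, w} \<Longrightarrow> orthogonal \<xi> y"
    using orthogonal_to_subspace_exists by blast
  show thesis
    using \<xi>(1) \<xi>(2)[of v] \<xi>(2)[of w]
    by (intro that[of \<xi>]) (auto simp: orthogonal_def inner_commute span_base)
qed

section \<open>Reaching every stress when a = b x u\<close>

lemma constraint_mem_hull:
  "(u, b, outer_product u u - outer_product b b + p *\<^sub>R mat 1, cross3 b u)
    \<in> wave_convex_hull mhd_constraint"
proof -
  have "mhd_constraint \<subseteq> mhd_space" by (auto simp: mhd_constraint_def)
  then show ?thesis
    by (intro subsetD[OF subset_wave_convex_hull])
      (auto simp: mhd_constraint_def mhd_space_def transpose_simps)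
qed

text \<open>The stress is measured relative to \<open>outer_product u u - outer_product b b\<close>,
  so that the multiples of the identity correspond to the points of the constraint set
  itself.\<close>

definition stress_hull :: "real^3 \<Rightarrow> real^3 \<Rightarrow> (real^3^3) set" where
  "stress_hull u b =
     {T. (u, b, outer_product u u - outer_product b b + T, cross3 b u)
        \<in> wave_convex_hull mhd_constraint}"

lemma stress_hull_rank_one: "p *\<^sub>R mat 1 + outer_product w w \<in> stress_hull u b"
proof -
  obtain \<xi> where \<xi>: "\<xi> \<noteq> 0" "w \<bullet> \<xi> = 0" "b \<bullet> \<xi> = 0"
    using orthogonal_to_pair_exists by blast
  define V where "V = (u, b, outer_product u u - outer_product b b
    + (p *\<^sub>R mat 1 + outer_product w w), cross3 b u)"
  \<comment> \<open>The endpoints are constraint points with velocities \<open>u + w\<close> and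
    \<open>u - w\<close>: the cross terms of their stresses form the direction \<open>W\<close>, and
    the square of \<open>w\<close> survives in the mean. As \<open>\<xi>\<close> is orthogonal to
    \<open>w\<close>, the stress of \<open>W\<close> sends it to
    \<open>(u \<bullet> \<xi>) *\<^sub>R w\<close>, whence
    \<open>c = - (u \<bullet> \<xi>)\<close>.\<close>
  define W where "W = (w, 0::real^3, outer_product u w + outer_product w u, cross3 b w)"
  have "cross3 \<xi> (cross3 b w) = 0"
    using \<xi> by (simp add: Lagrange inner_commute)
  then have "W \<in> wave_cone"
    unfolding W_def wave_cone_def mhd_space_def using \<xi>
    by (auto simp: transpose_simps outer_product_mult_vector matrix_vector_mult_add_rdistrib
        intro!: exI[of _ \<xi>] exI[of _ "- (u \<bullet> \<xi>)"])
  moreover have "V \<in> mhd_space"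
    unfolding V_def by (intro mhd_spaceI) (simp add: transpose_simps)
  moreover have "V + W = (u + w, b, outer_product (u + w) (u + w) - outer_product b b
      + p *\<^sub>R mat 1, cross3 b (u + w))"
    by (simp add: V_def W_def outer_product_simps cross_add_right)
  moreover have "V - W = (u - w, b, outer_product (u - w) (u - w) - outer_product b b
      + p *\<^sub>R mat 1, cross3 b (u - w))"
    by (simp add: V_def W_def outer_product_simps Cross3.right_diff_distrib)
  ultimately have "V \<in> wave_convex_hull mhd_constraint"
    using constraint_mem_hull by (auto intro: wave_convex_hull_midpoint)
  then show ?thesis by (simp add: stress_hull_def V_def)
qed

text \<open>The target is the midpoint of \<open>M\<close> plus twice the square of \<open>x\<close>
  and \<open>M\<close> plus twice the square of \<open>y\<close>; the difference of two squares has
  rank at most two, so it has a kernel vector \<open>\<xi>\<close>. Quantifying over all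
  \<open>x\<close> lets the rule iterate, with \<open>M + outer_product y y\<close> as the next
  \<open>M\<close>.\<close>

lemma stress_hull_add_rank_one:
  assumes M: "\<And>x. M + outer_product x x \<in> stress_hull u b"
  shows "M + outer_product y y + outer_product x x \<in> stress_hull u b"
proof -
  obtain \<xi> where \<xi>: "\<xi> \<noteq> 0" "x \<bullet> \<xi> = 0" "y \<bullet> \<xi> = 0"
    using orthogonal_to_pair_exists by blast
  define B where "B = outer_product u u - outer_product b b"
  define V where "V = (u, b, B + (M + outer_product y y + outer_product x x), cross3 b u)"
  define W where "W = (0::real^3, 0::real^3, outer_product x x - outer_product y y, 0::real^3)"
  have plus: "V + W = (u, b, B + (M + outer_product (sqrt 2 *\<^sub>R x) (sqrt 2 *\<^sub>R x)), cross3 b u)"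
    and minus: "V - W = (u, b, B + (M + outer_product (sqrt 2 *\<^sub>R y) (sqrt 2 *\<^sub>R y)), cross3 b u)"
    by (simp_all add: V_def W_def outer_product_simps scaleR_2)
  have sum: "V + W \<in> wave_convex_hull mhd_constraint" "V - W \<in> wave_convex_hull mhd_constraint"
    using M unfolding plus minus by (auto simp: stress_hull_def B_def)
  have W: "W \<in> wave_cone"
    unfolding W_def wave_cone_def mhd_space_def using \<xi>
    by (auto simp: transpose_simps outer_product_mult_vector matrix_vector_mult_diff_rdistrib
        intro!: exI[of _ \<xi>])
  \<comment> \<open>Symmetry of \<open>M\<close> is inherited from the endpoint, since the hull lies
    in \<open>mhd_space\<close>.\<close>
  have "transpose (B + (M + outer_product (sqrt 2 *\<^sub>R x) (sqrt 2 *\<^sub>R x)))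
      = B + (M + outer_product (sqrt 2 *\<^sub>R x) (sqrt 2 *\<^sub>R x))"
    using sum(1) wave_convex_hull_subset unfolding plus by (auto simp: mhd_space_def)
  then have "transpose M = M"
    by (simp add: transpose_simps B_def)
  then have "V \<in> mhd_space"
    unfolding V_def B_def by (intro mhd_spaceI) (simp add: transpose_simps)
  then have "V \<in> wave_convex_hull mhd_constraint"
    using W sum by (rule wave_convex_hull_midpoint)
  then show ?thesis by (simp add: stress_hull_def V_def B_def)
qed

text \<open>Three squares produce the off-diagonal entries, three squares of axis vectors correct
  the diagonal, and a multiple of the identity makes all corrections nonnegative.\<close>

lemma symmetric_mem_stress_hull:
  assumes T: "transpose T = T"
  shows "T \<in> stress_hull u b"
proof -
  have swap: "T $ i $ j = T $ j $ i" for i j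
    using arg_cong[OF T, of "\<lambda>M. M $ i $ j"] by (simp add: transpose_def)
  note sym = swap[of 2 1] swap[of 3 1] swap[of 3 2]
  define x y z where "x = T $ 1 $ 2" and "y = T $ 1 $ 3" and "z = T $ 2 $ 3"
  \<comment> \<open>The off-diagonal squares contribute \<open>x * x + y * y\<close>,
    \<open>1 + z * z\<close> and \<open>2\<close> to the diagonal; \<open>p\<close> is the least of
    the remaining diagonal entries, so the square roots below are real.\<close>
  define p where
    "p = min (T $ 1 $ 1 - x * x - y * y) (min (T $ 2 $ 2 - 1 - z * z) (T $ 3 $ 3 - 2))"
  define r where "r = sqrt (T $ 1 $ 1 - x * x - y * y - p)"
  define s where "s = sqrt (T $ 2 $ 2 - 1 - z * z - p)"
  define t where "t = sqrt (T $ 3 $ 3 - 2 - p)"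
  have "p \<le> T $ 1 $ 1 - x * x - y * y" "p \<le> T $ 2 $ 2 - 1 - z * z" "p \<le> T $ 3 $ 3 - 2"
    unfolding p_def by (rule min.cobounded1 min.coboundedI2 order_refl)+
  then have squares: "r * r = T $ 1 $ 1 - x * x - y * y - p" "s * s = T $ 2 $ 2 - 1 - z * z - p"
      "t * t = T $ 3 $ 3 - 2 - p"
    unfolding r_def s_def t_def by (simp_all only: real_sqrt_mult_self abs_of_nonneg diff_ge_0_iff_ge)
  have eq: "T = p *\<^sub>R mat 1
      + outer_product (vector [x, 1, 0]) (vector [x, 1, 0])
      + outer_product (vector [y, 0, 1]) (vector [y, 0, 1])
      + outer_product (vector [0, z, 1]) (vector [0, z, 1])
      + outer_product (vector [r, 0, 0]) (vector [r, 0, 0])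
      + outer_product (vector [0, s, 0]) (vector [0, s, 0])
      + outer_product (vector [0, 0, t]) (vector [0, 0, t])"
    unfolding vec_eq_iff forall_3
    by (simp add: outer_product_def mat_def sym squares x_def[symmetric] y_def[symmetric]
        z_def[symmetric])
  show ?thesis
    unfolding eq by (intro stress_hull_add_rank_one stress_hull_rank_one)
qed

section \<open>Reaching every a orthogonal to b\<close>

lemma mem_hull_cross:
  assumes "transpose S = S"
  shows "(u, b, S, cross3 b u) \<in> wave_convex_hull mhd_constraint"
proof -
  have "S - (outer_product u u - outer_product b b) \<in> stress_hull u b"
    by (rule symmetric_mem_stress_hull) (simp add: assms transpose_simps)
  then show ?thesis by (simp add: stress_hull_def)
qed

lemma orthogonal_mem_hull:
  assumes S: "transpose S = S" and orth: "b \<bullet> a = 0"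
  shows "(u, b, S, a) \<in> wave_convex_hull mhd_constraint"
proof (cases "a = cross3 b u")
  case True
  then show ?thesis using mem_hull_cross[OF S] by simp
next
  case False
  \<comment> \<open>The defect of \<open>a\<close> serves as the frequency vector, and orthogonality
    of \<open>a\<close> and \<open>b\<close> makes it orthogonal to \<open>b\<close>. Two vectors
    orthogonal to it with cross product \<open>\<xi>\<close> then repair the defect: the mean of the
    endpoint cross products is \<open>cross3 b u + cross3 \<beta> v\<close>.\<close>
  define \<xi> where "\<xi> = a - cross3 b u"
  have \<xi>: "\<xi> \<noteq> 0" using False by (simp add: \<xi>_def)
  have b: "\<xi> \<bullet> b = 0"
    using orth by (simp add: \<xi>_def inner_diff_left dot_cross_self inner_commute[of a b])
  obtain \<beta> where \<beta>: "\<beta> \<noteq> 0" "\<xi> \<bullet> \<beta> = 0"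
    using orthogonal_to_pair_exists by blast
  define v where "v = (1 / (\<beta> \<bullet> \<beta>)) *\<^sub>R cross3 \<xi> \<beta>"
  have v: "\<xi> \<bullet> v = 0" by (simp add: v_def dot_cross_self)
  have cross: "cross3 \<beta> v = \<xi>"
    using \<beta> by (simp add: v_def cross_mult_right Lagrange inner_commute)
  \<comment> \<open>The stress is free at both endpoints, so \<open>D\<close> is chosen solely to be
    symmetric and to cancel \<open>c *\<^sub>R v\<close> on \<open>\<xi>\<close> for
    \<open>c = - (\<xi> \<bullet> u)\<close>, the value forced by the magnetic equation.\<close>
  define D where "D = ((\<xi> \<bullet> u) / (\<xi> \<bullet> \<xi>)) *\<^sub>R (outer_product v \<xi> + outer_product \<xi> v)"
  have D: "transpose D = D" by (simp add: D_def transpose_simps add.commute)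
  have D\<xi>: "D *v \<xi> = (\<xi> \<bullet> u) *\<^sub>R v"
    using \<xi> v
    by (simp add: D_def outer_product_mult_vector matrix_vector_mult_add_rdistrib
        scaleR_matrix_vector_assoc[symmetric] inner_commute)
  define V where "V = (u, b, S, a)"
  define W where "W = (v, \<beta>, D, cross3 b v + cross3 \<beta> u)"
  have a: "a = cross3 b u + cross3 \<beta> v" by (simp add: cross \<xi>_def)
  have plus: "V + W = (u + v, b + \<beta>, S + D, cross3 (b + \<beta>) (u + v))"
    by (simp add: V_def W_def a cross_add_left cross_add_right algebra_simps)
  have minus: "V - W = (u - v, b - \<beta>, S - D, cross3 (b - \<beta>) (u - v))"
    by (simp add: V_def W_def a Cross3.left_diff_distrib Cross3.right_diff_distrib algebra_simps)
  have "cross3 \<xi> (cross3 b v + cross3 \<beta> u) = (\<xi> \<bullet> u) *\<^sub>R \<beta>"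
    using \<beta> b v by (simp add: cross_add_right Lagrange)
  then have W: "W \<in> wave_cone"
    unfolding W_def wave_cone_def mhd_space_def using \<xi> \<beta> v D D\<xi>
    by (auto simp: inner_commute intro!: exI[of _ \<xi>] exI[of _ "- (\<xi> \<bullet> u)"])
  have "V \<in> mhd_space" using S by (simp add: V_def mhd_space_def)
  moreover note W
  moreover have "V + W \<in> wave_convex_hull mhd_constraint"
    unfolding plus by (rule mem_hull_cross) (simp add: S D transpose_simps)
  moreover have "V - W \<in> wave_convex_hull mhd_constraint"
    unfolding minus by (rule mem_hull_cross) (simp add: S D transpose_simps)
  ultimately show ?thesis
    unfolding V_def[symmetric] by (rule wave_convex_hull_midpoint)
qed

section \<open>The hull and its interiors\<close>

theorem wave_convex_hull_mhd_constraint: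
  "wave_convex_hull mhd_constraint = {(u, b, S, a) \<in> mhd_space. b \<bullet> a = 0}"
proof (intro equalityI subsetI)
  fix W assume "W \<in> wave_convex_hull mhd_constraint"
  then show "W \<in> {(u, b, S, a) \<in> mhd_space. b \<bullet> a = 0}"
    using wave_convex_hull_orthogonal wave_convex_hull_subset by (cases W) blast
next
  fix W assume "W \<in> {(u, b, S, a) \<in> mhd_space. b \<bullet> a = 0}"
  then show "W \<in> wave_convex_hull mhd_constraint"
    using orthogonal_mem_hull by (cases W) (simp add: mhd_space_def)
qed

text \<open>Moving \<open>b\<close> and \<open>a\<close> together along \<open>e\<close> adds
  \<open>t * (e \<bullet> (a + b)) + t * t * (e \<bullet> e)\<close> to the form. The quadratic term
  is positive even where the linear one vanishes, as at the origin.\<close>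

lemma interior_of_orthogonal_eq_empty:
  "top_of_set mhd_space interior_of {(u, b, S, a) \<in> mhd_space. b \<bullet> a = 0} = {}"
proof (rule ccontr)
  assume "\<not> ?thesis"
  then obtain V X where V: "V \<in> X" and X: "openin (top_of_set mhd_space) X"
    and sub: "X \<subseteq> {(u, b, S, a) \<in> mhd_space. b \<bullet> a = 0}"
    by (auto simp: interior_of_def)
  obtain T where T: "open T" "X = mhd_space \<inter> T" using X by (auto simp: openin_open)
  obtain u b S a where V': "V = (u, b, S, a)" by (cases V) auto
  \<comment> \<open>The sign of \<open>e\<close> keeps the linear term nonnegative for
    \<open>t > 0\<close>, so it cannot cancel the quadratic one.\<close>
  obtain e where e: "e \<noteq> 0" "0 \<le> e \<bullet> (a + b)"
  proof (cases "0 \<le> axis 1 1 \<bullet> (a + b)")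
    case True
    then show thesis using that[of "axis 1 1"] by simp
  next
    case False
    then show thesis using that[of "- axis 1 1"] by simp
  qed
  define g where "g t = (u, b + t *\<^sub>R e, S, a + t *\<^sub>R e)" for t :: real
  have "(g \<longlongrightarrow> (u, b + 0 *\<^sub>R e, S, a + 0 *\<^sub>R e)) (at_right 0)"
    unfolding g_def by (intro tendsto_intros)
  moreover have "(u, b + 0 *\<^sub>R e, S, a + 0 *\<^sub>R e) \<in> T" using V T V' by simp
  ultimately have "eventually (\<lambda>t. g t \<in> T) (at_right 0)"
    using T(1) topological_tendstoD by blast
  moreover have "eventually (\<lambda>t::real. t > 0) (at_right 0)"
    by (rule eventually_at_right_less)
  ultimately have "eventually (\<lambda>t. g t \<in> T \<and> t > 0) (at_right 0)"
    by (rule eventually_conj)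
  then obtain t where t: "g t \<in> T" "t > 0"
    using eventually_happens[of _ "at_right (0::real)"] by auto
  have ba: "b \<bullet> a = 0" and S: "transpose S = S"
    using V V' sub by (auto simp: mhd_space_def)
  have "g t \<in> mhd_space" using S by (simp add: g_def mhd_space_def)
  then have "(b + t *\<^sub>R e) \<bullet> (a + t *\<^sub>R e) = 0"
    using t(1) T(2) sub by (auto simp: g_def)
  then have "t * (e \<bullet> (a + b)) + t * t * (e \<bullet> e) = 0"
    using ba by (simp add: inner_simps algebra_simps inner_commute)
  moreover have "t * (e \<bullet> (a + b)) \<ge> 0" using t(2) e(2) by simp
  moreover have "t * t * (e \<bullet> e) > 0" using t(2) e(1) by simp
  ultimately show False by linarith
qed

theorem theorem1p4:
  shows "top_of_set mhd_space interior_of wave_convex_hull mhd_constraint = {} \<and>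
    (0, 0, 0, 0) \<in> top_of_set {(u, b, S, a) \<in> mhd_space. b \<bullet> a = 0}
      interior_of wave_convex_hull mhd_constraint"
proof
  show "top_of_set mhd_space interior_of wave_convex_hull mhd_constraint = {}"
    unfolding wave_convex_hull_mhd_constraint by (rule interior_of_orthogonal_eq_empty)
  have "(0, 0, 0, 0) \<in> {(u, b, S, a) \<in> mhd_space. b \<bullet> a = 0}"
    by (simp add: mhd_space_def transpose_def vec_eq_iff)
  \<comment> \<open>The hull is the whole carrier of this subspace topology, hence equal to its own
    relative interior.\<close>
  then show "(0, 0, 0, 0) \<in> top_of_set {(u, b, S, a) \<in> mhd_space. b \<bullet> a = 0}
      interior_of wave_convex_hull mhd_constraint"
    unfolding wave_convex_hull_mhd_constraint
    using interior_of_topspace[of "top_of_set {(u, b, S, a) \<in> mhd_space. b \<bullet> a = 0}"]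
    by (simp only: topspace_euclidean_subtopology)
qed

end
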